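(* Let $N\in\mathbb{N}$ and let $u\in L^1(\mathbb{S}^N)$ be Dini continuous at some $z\in\mathbb{S}^N$. Then $\mathscr{P}^{\log}_g u(z)$ is well defined (the integral in its definition converges). Moreover, if $u$ is uniformly Dini continuous in $\mathbb{S}^N$, then $\mathscr{P}^{\log}_g u$ is continuous on $\mathbb{S}^N$.
   Context: $\mathbb{S}^N\subset\mathbb{R}^{N+1}$ is the unit sphere with round metric $g$, volume element $dV_g$ and geodesic distance $d_g$; $|z-\zeta|$ is the Euclidean distance in $\mathbb{R}^{N+1}$. The conformal logarithmic Laplacian is $$\mathscr{P}^{\log}_g u(z)=c_N\int_{\mathbb{S}^N}\frac{u(z)-u(\zeta)}{|z-\zeta|^N}\,dV_g(\zeta)+A_Nu(z),\qquad c_N=\pi^{-N/2}\Gamma(\tfrac N2),\quad A_N=2\psi(\tfrac N2),$$ with $\psi=\Gamma'/\Gamma$. For a measurable $u:\mathbb{S}^N\to\mathbb{R}$, the modulus of continuity at $z$ is $\omega_{u,z}(r)=\sup_{\zeta\in\mathbb{S}^N,\,d_g(z,\zeta)\le r}|u(z)-u(\zeta)|$ for $r>0$. The function $u$ is Dini continuous at $z$ if $\int_0^1\frac{\omega_{u,z}(r)}{r}\,dr<\infty$. With $\omega_u(r):=\sup_{z\in\mathbb{S}^N}\omega_{u,z}(r)$, $u$ is uniformly Dini continuous in $\mathbb{S}^N$ if $\int_0^1\frac{\omega_u(r)}{r}\,dr<\infty$. *)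

theory Defs
  imports "HOL-Analysis.Analysis"
begin

text \<open>
  The ambient space \<open>\<real>\<^sup>N\<^sup>+\<^sup>1\<close> is a Euclidean space \<open>'a\<close> with \<open>DIM('a) = N + 1\<close>, and the
  sphere is \<open>sphere (0::'a) 1\<close>. Functions on the sphere are functions on \<open>'a\<close>, of which
  only the values on the sphere are ever used.

  The surface measure of the unit sphere is the measure \<open>\<sigma>\<close> of integration in polar
  coordinates, \<open>dx = r\<^sup>N dr d\<sigma>\<close>: the push-forward of Lebesgue measure on the punctured unit
  ball under the radial projection, divided by \<open>\<integral>\<^sub>0\<^sup>1 r\<^sup>N dr = 1 / (N + 1)\<close>.
\<close>

definition sphere_borel_measure :: "'a::euclidean_space measure" where
  "sphere_borel_measure =
     scale_measure (of_nat DIM('a))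
       (distr (restrict_space lborel (cball 0 1 - {0}))
              (restrict_space borel (sphere 0 1))
              (\<lambda>x. x /\<^sub>R norm x))"

text \<open>Completed, so that measurability of functions on the sphere is Lebesgue measurability.\<close>

definition sphere_measure :: "'a::euclidean_space measure" where
  "sphere_measure = completion sphere_borel_measure"

definition geodesic_dist :: "'a::euclidean_space \<Rightarrow> 'a \<Rightarrow> real" where
  "geodesic_dist z \<zeta> = arccos (z \<bullet> \<zeta>)"

text \<open>The moduli of continuity take values in \<open>[0, \<infinity>]\<close>, as \<open>u\<close> need not be bounded.\<close>

definition modulus_at :: "('a::euclidean_space \<Rightarrow> real) \<Rightarrow> 'a \<Rightarrow> real \<Rightarrow> ennreal" where
  "modulus_at u z r =
     (SUP \<zeta>\<in>{\<zeta> \<in> sphere 0 1. geodesic_dist z \<zeta> \<le> r}. ennreal \<bar>u z - u \<zeta>\<bar>)"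

definition modulus :: "('a::euclidean_space \<Rightarrow> real) \<Rightarrow> real \<Rightarrow> ennreal" where
  "modulus u r = (SUP z\<in>sphere 0 1. modulus_at u z r)"

definition Dini_continuous_at :: "('a::euclidean_space \<Rightarrow> real) \<Rightarrow> 'a \<Rightarrow> bool" where
  "Dini_continuous_at u z \<longleftrightarrow>
     (\<integral>\<^sup>+ r\<in>{0<..<1}. modulus_at u z r / ennreal r \<partial>lborel) < \<infinity>"

definition uniformly_Dini_continuous :: "('a::euclidean_space \<Rightarrow> real) \<Rightarrow> bool" where
  "uniformly_Dini_continuous u \<longleftrightarrow>
     (\<integral>\<^sup>+ r\<in>{0<..<1}. modulus u r / ennreal r \<partial>lborel) < \<infinity>"

definition c_const :: "nat \<Rightarrow> real" where
  "c_const N = pi powr (- (real N / 2)) * Gamma (real N / 2)"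

definition A_const :: "nat \<Rightarrow> real" where
  "A_const N = 2 * Digamma (real N / 2)"

text \<open>
  At \<open>\<zeta> = z\<close> the quotient below is \<open>0 / 0 = 0\<close> for \<open>N \<ge> 1\<close>; this concerns a single point,
  a null set of the surface measure.
\<close>

definition log_kernel_integrand ::
    "nat \<Rightarrow> ('a::euclidean_space \<Rightarrow> real) \<Rightarrow> 'a \<Rightarrow> 'a \<Rightarrow> real" where
  "log_kernel_integrand N u z \<zeta> = (u z - u \<zeta>) / norm (z - \<zeta>) ^ N"

definition conf_log_laplacian ::
    "nat \<Rightarrow> ('a::euclidean_space \<Rightarrow> real) \<Rightarrow> 'a \<Rightarrow> real" where
  "conf_log_laplacian N u z =
     c_const N * (\<integral>\<zeta>. log_kernel_integrand N u z \<zeta> \<partial>sphere_measure) + A_const N * u z"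

lemma Digamma_eq_deriv_Gamma:
  assumes "(x::real) > 0"
  shows "Digamma x = deriv Gamma x / Gamma x"
proof -
  have "x \<notin> \<int>\<^sub>\<le>\<^sub>0"
    using assms nonpos_Ints_nonpos[of x] by force
  then have "deriv Gamma x = Gamma x * Digamma x"
    using has_field_derivative_Gamma[of x UNIV, THEN DERIV_imp_deriv] by simp
  then show ?thesis
    using Gamma_real_pos[OF assms] by simp
qed

text \<open>Checks of the normalisation of the surface measure.\<close>

lemma radial_projection_measurable:
  "(\<lambda>x. x /\<^sub>R norm x) \<in> measurable (restrict_space lborel (cball 0 1 - {0}))
     (restrict_space borel (sphere (0::'a::euclidean_space) 1))"
proof (rule measurable_restrict_space2)
  show "(\<lambda>x::'a. x /\<^sub>R norm x) \<in> space (restrict_space lborel (cball 0 1 - {0})) \<rightarrow> sphere 0 1"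
    by (auto simp: space_restrict_space)
  show "(\<lambda>x::'a. x /\<^sub>R norm x) \<in> borel_measurable (restrict_space lborel (cball 0 1 - {0}))"
    by (rule measurable_restrict_space1) measurable
qed

lemma space_sphere_measure: "space sphere_measure = sphere (0::'a::euclidean_space) 1"
  by (simp add: sphere_measure_def sphere_borel_measure_def space_scale_measure space_restrict_space)

lemma emeasure_sphere_measure:
  fixes A :: "'a::euclidean_space set"
  assumes "A \<in> sets borel" "A \<subseteq> sphere 0 1"
  shows "emeasure sphere_measure A =
    of_nat DIM('a) * emeasure lborel {x \<in> cball 0 1 - {0}. x /\<^sub>R norm x \<in> A}"
proof -
  have A: "A \<in> sets (restrict_space borel (sphere (0::'a) 1))"
    using assms by (auto simp: sets_restrict_space_iff)
  have eq: "(\<lambda>x. x /\<^sub>R norm x) -` A \<inter> (cball 0 1 - {0}) = {x \<in> cball 0 1 - {0}. x /\<^sub>R norm x \<in> A}"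
    by auto
  have "emeasure sphere_measure A = emeasure sphere_borel_measure A"
    using A by (simp add: sphere_measure_def sphere_borel_measure_def)
  also have "\<dots> = of_nat DIM('a) * emeasure (restrict_space lborel (cball 0 1 - {0}))
      {x \<in> cball 0 1 - {0}. x /\<^sub>R norm x \<in> A}"
    using A by (simp add: sphere_borel_measure_def eq space_restrict_space
        emeasure_distr[OF radial_projection_measurable])
  also have "emeasure (restrict_space lborel (cball 0 1 - {0}))
      {x \<in> cball 0 1 - {0}. x /\<^sub>R norm x \<in> A} = emeasure lborel {x \<in> cball 0 1 - {0}. x /\<^sub>R norm x \<in> A}"
    by (rule emeasure_restrict_space) auto
  finally show ?thesis .
qed

lemma emeasure_sphere_measure_sphere:
  "emeasure sphere_measure (sphere (0::'a::euclidean_space) 1) =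
     ennreal (2 * pi powr (DIM('a) / 2) / Gamma (DIM('a) / 2))"
proof -
  let ?d = "real DIM('a)"
  have "{x \<in> cball 0 1 - {0}. x /\<^sub>R norm x \<in> sphere (0::'a) 1} = cball 0 1 - {0}"
    by auto
  then have "emeasure sphere_measure (sphere (0::'a) 1) =
      of_nat DIM('a) * emeasure lborel (cball (0::'a) 1 - {0})"
    by (simp add: emeasure_sphere_measure)
  also have "emeasure lborel (cball (0::'a) 1 - {0}) = emeasure lborel (cball (0::'a) 1)"
    by (rule emeasure_Diff_null_set) auto
  also have "\<dots> = ennreal (unit_ball_vol ?d)"
    by (simp add: emeasure_cball)
  also have "of_nat DIM('a) * ennreal (unit_ball_vol ?d) = ennreal (?d * unit_ball_vol ?d)"
    by (simp add: ennreal_mult ennreal_of_nat_eq_real_of_nat)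
  also have "?d * unit_ball_vol ?d = 2 * pi powr (?d / 2) / Gamma (?d / 2)"
  proof -
    have *: "Gamma (?d / 2 + 1) = ?d / 2 * Gamma (?d / 2)"
      using Gamma_plus1[of "?d / 2"] nonpos_Ints_nonpos[of "?d / 2"] by force
    show ?thesis
      unfolding unit_ball_vol_def * by simp
  qed
  finally show ?thesis .
qed

end

theory Submission
  imports Defs
begin

text \<open>
  Spherical caps of radius \<open>r\<close> have measure at most \<open>C r\<^sup>N\<close>, so Tonelli's theorem bounds
  \<open>\<integral>\<^bsub>|z - \<zeta>| < \<delta>\<^esub> |u z - u \<zeta>| / |z - \<zeta>|\<^sup>N d\<sigma>\<close> by a multiple of \<open>\<integral>\<^sub>0\<^bsup>6 \<delta>\<^esup> \<omega> r / r dr\<close>. This gives convergence at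
  a point of Dini continuity, since the integrand is harmless away from \<open>z\<close>. In the uniform case the
  bound tends to \<open>0\<close> uniformly in \<open>z\<close>, so the integral is a uniform limit of the integrals with
  truncated kernel \<open>1 / max |z - \<zeta>| \<delta> ^ N\<close>, which are continuous in \<open>z\<close> by dominated convergence.
\<close>

section \<open>Measure of spherical caps\<close>

text \<open>The cone is covered by about \<open>1 / r\<close> balls of radius \<open>2 r\<close> centred on the segment from \<open>0\<close> to \<open>z\<close>.\<close>

lemma emeasure_cone_le:
  fixes z :: "'a::euclidean_space"
  assumes z: "norm z = 1" and r: "0 < r" "r \<le> 1"
  shows "emeasure lborel {x \<in> cball 0 1 - {0}. dist z (x /\<^sub>R norm x) \<le> r}
    \<le> ennreal (3 / r * (unit_ball_vol DIM('a) * (2 * r) ^ DIM('a)))"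
proof -
  \<comment> \<open>\<open>m\<close> is chosen so that consecutive centres on the segment are at
    most \<open>r\<close> apart.\<close>
  define m where "m = nat \<lceil>1 / r\<rceil>"
  have m_ge: "1 / r \<le> real m" and m_le: "real m \<le> 1 / r + 1"
    unfolding m_def using r by (auto simp: of_nat_nat)
  have m_pos: "m > 0"
    using m_ge r by (cases m) (auto simp: divide_simps)
  have inv_m: "1 / real m \<le> r"
    using m_ge m_pos r by (simp add: divide_simps mult.commute)
  let ?B = "\<lambda>k. cball ((real k / real m) *\<^sub>R z) (2 * r)"
  let ?V = "unit_ball_vol (real DIM('a)) * (2 * r) ^ DIM('a)"
  have "{x \<in> cball 0 1 - {0}. dist z (x /\<^sub>R norm x) \<le> r} \<subseteq> (\<Union>k\<le>m. ?B k)"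
  proof (rule subsetI)
    fix x :: 'a
    assume "x \<in> {x \<in> cball 0 1 - {0}. dist z (x /\<^sub>R norm x) \<le> r}"
    then have x: "x \<in> cball 0 1" "x \<noteq> 0" and dx: "dist z (x /\<^sub>R norm x) \<le> r"
      by auto
    \<comment> \<open>The nearest centre below \<open>norm x\<close> on the segment;
      \<open>norm x \<le> 1\<close> keeps the index in the range \<open>0..m\<close>.\<close>
    define k where "k = nat \<lfloor>norm x * real m\<rfloor>"
    have k: "real k \<le> norm x * real m" "norm x * real m < real k + 1"
      unfolding k_def by (auto simp: of_nat_nat)
    have "norm x * real m \<le> real m"
      using x by (intro mult_left_le_one_le) auto
    then have "k \<le> m"
      using k by linarith
    have "norm x - real k / real m \<le> 1 / real m"
      using k m_pos divide_right_mono[of "norm x * real m - real k" 1 "real m"]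
      by (simp add: diff_divide_distrib)
    moreover have "0 \<le> norm x - real k / real m"
      using k m_pos by (simp add: divide_simps)
    ultimately have 1: "norm ((norm x - real k / real m) *\<^sub>R z) \<le> r"
      using z inv_m by simp
    \<comment> \<open>The error splits into a radial one, from rounding \<open>norm x\<close> down,
      and an angular one, from replacing the direction of \<open>x\<close> by \<open>z\<close>. Each
      is at most \<open>r\<close>, hence the radius \<open>2 * r\<close>.\<close>
    have "x - norm x *\<^sub>R z = norm x *\<^sub>R (x /\<^sub>R norm x - z)"
      using x by (simp add: scaleR_diff_right)
    then have "norm (x - norm x *\<^sub>R z) = norm x * dist z (x /\<^sub>R norm x)"
      by (metis abs_norm_cancel dist_commute dist_norm norm_scaleR)
    also have "\<dots> \<le> 1 * r"
      using x dx by (intro mult_mono) auto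
    finally have 2: "norm (x - norm x *\<^sub>R z) \<le> r" by simp
    have "norm (x - (real k / real m) *\<^sub>R z)
        = norm ((x - norm x *\<^sub>R z) + (norm x - real k / real m) *\<^sub>R z)"
      by (simp add: scaleR_diff_left)
    also have "\<dots> \<le> r + r"
      by (rule order_trans[OF norm_triangle_ineq]) (use 1 2 in linarith)
    finally have "x \<in> ?B k"
      by (simp add: dist_norm norm_minus_commute)
    with \<open>k \<le> m\<close> show "x \<in> (\<Union>k\<le>m. ?B k)" by blast
  qed
  then have "emeasure lborel {x \<in> cball 0 1 - {0}. dist z (x /\<^sub>R norm x) \<le> r}
      \<le> emeasure lborel (\<Union>k\<le>m. ?B k)"
    by (intro emeasure_mono) auto
  also have "\<dots> \<le> (\<Sum>k\<le>m. emeasure lborel (?B k))"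
    by (rule emeasure_subadditive_finite) auto
  also have "\<dots> = ennreal (real (m + 1) * ?V)"
    using r by (simp add: emeasure_cball ennreal_of_nat_eq_real_of_nat ennreal_mult' del: of_nat_Suc)
  also have "\<dots> \<le> ennreal (3 / r * ?V)"
  proof (intro ennreal_leI mult_right_mono)
    \<comment> \<open>Here \<open>r \<le> 1\<close> enters: \<open>m + 1\<close> is at most
      \<open>1 / r + 2\<close>, and \<open>2 \<le> 2 / r\<close>.\<close>
    show "real (m + 1) \<le> 3 / r"
      using m_le r by (simp add: field_simps)
  qed (use r in auto)
  finally show ?thesis .
qed

text \<open>For \<open>r \<le> 1\<close> the cone over the cap is covered by at most
  \<open>3 / r\<close> balls of volume of order \<open>r ^ (N + 1)\<close>, which leaves
  \<open>r ^ N\<close>. For larger \<open>r\<close> the volume of the whole ball suffices, as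
  \<open>r ^ N \<ge> 1\<close>. That \<open>C\<close> is the same for all \<open>z\<close> is what
  later makes the estimates uniform.\<close>

lemma emeasure_spherical_cap_le:
  assumes d: "DIM('a::euclidean_space) = N + 1"
  shows "\<exists>C>0. \<forall>z \<in> sphere (0::'a) 1. \<forall>r>0.
    emeasure sphere_measure {\<zeta> \<in> sphere 0 1. dist z \<zeta> \<le> r} \<le> ennreal (C * r ^ N)"
proof -
  define V where "V = unit_ball_vol (real DIM('a))"
  define C where "C = real DIM('a) * (3 * V * 2 ^ (N + 1))"
  have V: "V > 0" by (simp add: V_def unit_ball_vol_pos)
  have "emeasure sphere_measure {\<zeta> \<in> sphere 0 1. dist z \<zeta> \<le> r} \<le> ennreal (C * r ^ N)"
    if z: "z \<in> sphere (0::'a) 1" and r: "r > 0" for z r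
  proof -
    let ?A = "{\<zeta> \<in> sphere 0 1. dist z \<zeta> \<le> r}"
    let ?K = "{x \<in> cball 0 1 - {0}. dist z (x /\<^sub>R norm x) \<le> r}"
    have "?A = sphere 0 1 \<inter> cball z r" by auto
    then have "?A \<in> sets borel" by simp
    then have "emeasure sphere_measure ?A =
        of_nat DIM('a) * emeasure lborel {x \<in> cball 0 1 - {0}. x /\<^sub>R norm x \<in> ?A}"
      by (rule emeasure_sphere_measure) auto
    also have "{x \<in> cball 0 1 - {0}. x /\<^sub>R norm x \<in> ?A} = ?K"
      by auto
    also have "emeasure lborel ?K \<le> ennreal (3 * V * 2 ^ (N + 1) * r ^ N)"
    proof (cases "r \<le> 1")
      case True
      then show ?thesis
        using emeasure_cone_le[of z r] z r by (simp add: V_def d power_mult_distrib mult_ac)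
    next
      case False
      have "emeasure lborel ?K \<le> emeasure lborel (cball (0::'a) 1)"
        by (rule emeasure_mono) auto
      also have "\<dots> = ennreal V"
        by (simp add: emeasure_cball V_def)
      also have "\<dots> \<le> ennreal (3 * V * 2 ^ (N + 1) * r ^ N)"
      proof (rule ennreal_leI)
        have "1 * 1 \<le> (3 * 2 ^ (N + 1)) * r ^ N"
          using False one_le_power[of r N] one_le_power[of "2::real" "N + 1"]
          by (intro mult_mono) linarith+
        with V show "V \<le> 3 * V * 2 ^ (N + 1) * r ^ N"
          using mult_left_mono[of 1 "3 * 2 ^ (N + 1) * r ^ N" V] by (simp add: mult_ac)
      qed
      finally show ?thesis .
    qed
    also have "of_nat DIM('a) * ennreal (3 * V * 2 ^ (N + 1) * r ^ N) = ennreal (C * r ^ N)"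
      using V r by (simp add: C_def ennreal_of_nat_eq_real_of_nat ennreal_mult mult_ac)
    finally show ?thesis
      by (simp add: mult_left_mono)
  qed
  moreover have "C > 0" using V d by (simp add: C_def)
  ultimately show ?thesis by blast
qed

section \<open>Geodesic and Euclidean distance\<close>

text \<open>With \<open>x\<close> half the angle, the chord has length \<open>2 * sin x\<close>.
  Since \<open>x < 2\<close>, the Taylor bound \<open>sin x \<ge> x - x ^ 3 / 6\<close> gives
  \<open>sin x \<ge> x / 3\<close>. The moduli use geodesic distance and the kernel Euclidean
  distance; the factor 3 pays for the change.\<close>

lemma geodesic_dist_le:
  assumes "z \<in> sphere 0 1" "\<zeta> \<in> sphere 0 1"
  shows "geodesic_dist z \<zeta> \<le> 3 * dist z \<zeta>"
proof -
  define x where "x = geodesic_dist z \<zeta> / 2"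
  have n: "norm z = 1" "norm \<zeta> = 1" using assms by auto
  have b: "\<bar>z \<bullet> \<zeta>\<bar> \<le> 1"
    using Cauchy_Schwarz_ineq2[of z \<zeta>] n by simp
  have x: "0 \<le> x" "x < 2"
    using arccos_bounded[of "z \<bullet> \<zeta>"] b pi_less_4 unfolding x_def geodesic_dist_def by linarith+
  have "\<bar>sin x - x\<bar> \<le> x ^ 3 / 6"
    using Maclaurin_sin_bound[of x 3] x
    by (simp add: numeral_3_eq_3 sin_coeff_def fact_numeral divide_simps)
  moreover have "x ^ 3 \<le> x * 4"
    using mult_mono[of x 2 x 2] x mult_left_mono[of "x * x" 4 x] by (simp add: power3_eq_cube mult_ac)
  ultimately have sin_x: "x / 3 \<le> sin x" by linarith
  have "cos (2 * x) = z \<bullet> \<zeta>"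
    using b by (simp add: x_def geodesic_dist_def cos_arccos_abs)
  then have "(dist z \<zeta>)\<^sup>2 = (2 * sin x)\<^sup>2"
    using n by (simp add: dist_norm power2_norm_eq_inner inner_diff cos_double_sin
        inner_commute power_mult_distrib norm_eq_1)
  then have "dist z \<zeta> = 2 * sin x"
    using sin_x x by (subst (asm) power2_eq_iff_nonneg) auto
  then show ?thesis
    using sin_x by (simp add: x_def)
qed

section \<open>Integrals of monotone moduli against the singular kernel\<close>

text \<open>Superlevel sets of a monotone function are intervals. This makes the moduli measurable
  although they are suprema over uncountable families.\<close>

lemma borel_measurable_ennreal_mono:
  fixes W :: "real \<Rightarrow> ennreal"
  assumes "mono W"
  shows "W \<in> borel_measurable borel"
proof (rule borel_measurableI_greater)
  fix y
  have "is_interval {x. y < W x}"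
    unfolding is_interval_1 using monoD[OF assms] by (auto intro: less_le_trans)
  then have "{x. y < W x} \<in> sets borel"
    by (rule real_interval_borel_measurable)
  then show "{x \<in> space borel. y < W x} \<in> sets borel" by simp
qed

text \<open>On an interval of length \<open>s\<close> the integrand is at least
  \<open>W s / (2 * s) ^ (N + 1)\<close>, by monotonicity of both factors; the constant
  \<open>2 ^ (N + 1)\<close> undoes the doubling of \<open>s\<close>. A value of \<open>W\<close>
  thus becomes an integral, to which Tonelli's theorem or a Dini condition can be applied.\<close>

lemma mono_le_nn_integral_scale:
  fixes W :: "real \<Rightarrow> ennreal"
  assumes "mono W" and s: "0 < s"
  shows "W s * ennreal (1 / s ^ N)
    \<le> ennreal (2 ^ (N + 1)) * (\<integral>\<^sup>+ r\<in>{s..<2 * s}. W r * ennreal (1 / r ^ (N + 1)) \<partial>lborel)"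
proof -
  have "W s * ennreal (1 / s ^ N)
      = ennreal (2 ^ (N + 1)) * (W s * ennreal (1 / (2 * s) ^ (N + 1)) * ennreal s)"
    using s by (simp add: ennreal_mult[symmetric] mult_ac power_mult_distrib
        mult.left_commute[of "ennreal _" "W s"])
  also have "W s * ennreal (1 / (2 * s) ^ (N + 1)) * ennreal s
      = (\<integral>\<^sup>+ r\<in>{s..<2 * s}. W s * ennreal (1 / (2 * s) ^ (N + 1)) \<partial>lborel)"
    using s by (simp add: nn_integral_cmult_indicator)
  also have "\<dots> \<le> (\<integral>\<^sup>+ r\<in>{s..<2 * s}. W r * ennreal (1 / r ^ (N + 1)) \<partial>lborel)"
  proof (intro nn_integral_mono)
    fix r
    show "W s * ennreal (1 / (2 * s) ^ (N + 1)) * indicator {s..<2 * s} r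
        \<le> W r * ennreal (1 / r ^ (N + 1)) * indicator {s..<2 * s} r"
    proof (cases "r \<in> {s..<2 * s}")
      case True
      then have "r ^ (N + 1) \<le> (2 * s) ^ (N + 1)"
        using s by (intro power_mono) auto
      with True s have "W s * ennreal (1 / (2 * s) ^ (N + 1)) \<le> W r * ennreal (1 / r ^ (N + 1))"
        by (intro mult_mono monoD[OF \<open>mono W\<close>] ennreal_leI divide_left_mono mult_pos_pos zero_less_power) auto
      with True show ?thesis by simp
    qed simp
  qed
  finally show ?thesis by (simp add: mult_left_mono)
qed


lemma finite_measure_sphere_measure: "finite_measure (sphere_measure :: 'a::euclidean_space measure)"
  by (rule finite_measureI) (simp add: space_sphere_measure emeasure_sphere_measure_sphere)

lemma borel_measurable_sphere_measure:
  assumes "f \<in> borel_measurable borel"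
  shows "f \<in> borel_measurable (sphere_measure :: 'a::euclidean_space measure)"
proof -
  have "f \<in> measurable (restrict_space borel (sphere 0 1)) borel"
    using assms by (rule measurable_restrict_space1)
  then have "f \<in> borel_measurable (sphere_borel_measure :: 'a measure)"
    by (simp add: sphere_borel_measure_def measurable_def space_scale_measure)
  then show ?thesis
    unfolding sphere_measure_def by (rule measurable_completion)
qed

text \<open>Averaging \<open>W\<close> over \<open>[s, 2 s)\<close> with \<open>s = 3 |z - \<zeta>|\<close> turns the left-hand side into a double
  integral; by Tonelli's theorem the integration over \<open>\<zeta>\<close> comes first and meets only the measure of
  spherical caps.\<close>

lemma nn_integral_singular_kernel_le:
  fixes W :: "real \<Rightarrow> ennreal" and z :: "'a::euclidean_space"
  assumes W: "mono W"
    and cap: "\<And>r. 0 < r \<Longrightarrow>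
      emeasure sphere_measure {\<zeta> \<in> sphere 0 1. dist z \<zeta> \<le> r} \<le> ennreal (C * r ^ N)"
  shows "(\<integral>\<^sup>+ \<zeta>. W (3 * dist z \<zeta>) * ennreal (1 / dist z \<zeta> ^ N) *
        indicator {\<zeta>. 0 < dist z \<zeta> \<and> dist z \<zeta> < \<delta>} \<zeta> \<partial>sphere_measure)
    \<le> ennreal (3 ^ N * 2 ^ (N + 1) * C) * (\<integral>\<^sup>+ r\<in>{0<..<6 * \<delta>}. W r / ennreal r \<partial>lborel)"
proof -
  let ?S = "sphere_measure :: 'a measure"
  let ?K = "ennreal (3 ^ N * 2 ^ (N + 1))"
  \<comment> \<open>The region forgets the upper end \<open>2 * s\<close> of the averaging interval,
    keeping only \<open>r < 6 * \<delta>\<close>; for fixed \<open>r\<close> the section in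
    \<open>\<zeta>\<close> is then a full cap. It is written as a set of pairs because Tonelli's
    theorem needs joint measurability.\<close>
  define H where "H r \<zeta> = W r * ennreal (1 / r ^ (N + 1)) *
    indicator {p::real \<times> 'a. 0 < fst p \<and> fst p < 6 * \<delta> \<and> 3 * dist z (snd p) \<le> fst p} (r, \<zeta>)" for r \<zeta>
  interpret S: finite_measure ?S by (rule finite_measure_sphere_measure)
  interpret P: pair_sigma_finite lborel ?S ..
  have [measurable]: "W \<in> borel_measurable borel"
    by (rule borel_measurable_ennreal_mono[OF W])
  have [measurable]: "(\<lambda>\<zeta>. dist z \<zeta>) \<in> borel_measurable ?S"
    by (rule borel_measurable_sphere_measure) measurable
  have H: "case_prod H \<in> borel_measurable (lborel \<Otimes>\<^sub>M ?S)"
    unfolding H_def by measurable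
  have [measurable]: "(\<lambda>\<zeta>. \<integral>\<^sup>+ r. H r \<zeta> \<partial>lborel) \<in> borel_measurable ?S"
    unfolding H_def by measurable
  have "W (3 * dist z \<zeta>) * ennreal (1 / dist z \<zeta> ^ N) *
        indicator {\<zeta>. 0 < dist z \<zeta> \<and> dist z \<zeta> < \<delta>} \<zeta> \<le> ?K * (\<integral>\<^sup>+ r. H r \<zeta> \<partial>lborel)" for \<zeta>
  proof (cases "0 < dist z \<zeta> \<and> dist z \<zeta> < \<delta>")
    case True
    let ?s = "3 * dist z \<zeta>"
    \<comment> \<open>The factor \<open>3 ^ N\<close> comes from passing from
      \<open>dist z \<zeta>\<close> to \<open>?s\<close> in the denominator.\<close>
    have "W ?s * ennreal (1 / dist z \<zeta> ^ N) = ennreal (3 ^ N) * (W ?s * ennreal (1 / ?s ^ N))"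
      using True by (simp add: ennreal_mult[symmetric] mult_ac power_mult_distrib
          mult.left_commute[of "ennreal _" "W ?s"])
    also have "\<dots> \<le> ennreal (3 ^ N) * (ennreal (2 ^ (N + 1)) *
        (\<integral>\<^sup>+ r\<in>{?s..<2 * ?s}. W r * ennreal (1 / r ^ (N + 1)) \<partial>lborel))"
      using True by (intro mult_left_mono mono_le_nn_integral_scale[OF W]) auto
    also have "\<dots> \<le> ennreal (3 ^ N) * (ennreal (2 ^ (N + 1)) * (\<integral>\<^sup>+ r. H r \<zeta> \<partial>lborel))"
      using True unfolding H_def
      by (intro mult_left_mono nn_integral_mono) (auto simp: indicator_def)
    finally show ?thesis
      using True by (simp add: ennreal_mult mult.assoc)
  qed simp
  then have "(\<integral>\<^sup>+ \<zeta>. W (3 * dist z \<zeta>) * ennreal (1 / dist z \<zeta> ^ N) *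
        indicator {\<zeta>. 0 < dist z \<zeta> \<and> dist z \<zeta> < \<delta>} \<zeta> \<partial>?S)
      \<le> (\<integral>\<^sup>+ \<zeta>. ?K * (\<integral>\<^sup>+ r. H r \<zeta> \<partial>lborel) \<partial>?S)"
    by (rule nn_integral_mono)
  also have "\<dots> = ?K * (\<integral>\<^sup>+ \<zeta>. (\<integral>\<^sup>+ r. H r \<zeta> \<partial>lborel) \<partial>?S)"
    by (intro nn_integral_cmult) measurable
  also have "(\<integral>\<^sup>+ \<zeta>. (\<integral>\<^sup>+ r. H r \<zeta> \<partial>lborel) \<partial>?S) = (\<integral>\<^sup>+ r. (\<integral>\<^sup>+ \<zeta>. H r \<zeta> \<partial>?S) \<partial>lborel)"
    by (rule P.Fubini'[OF H])
  also have "\<dots> \<le> (\<integral>\<^sup>+ r. ennreal C * (W r / ennreal r * indicator {0<..<6 * \<delta>} r) \<partial>lborel)"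
  proof (rule nn_integral_mono)
    fix r :: real
    show "(\<integral>\<^sup>+ \<zeta>. H r \<zeta> \<partial>?S) \<le> ennreal C * (W r / ennreal r * indicator {0<..<6 * \<delta>} r)"
    proof (cases "r \<in> {0<..<6 * \<delta>}")
      case True
      let ?A = "{\<zeta> \<in> sphere 0 1. dist z \<zeta> \<le> r / 3}"
      have "?A = {\<zeta> \<in> space ?S. dist z \<zeta> \<le> r / 3}"
        by (simp add: space_sphere_measure)
      also have "\<dots> \<in> sets ?S" by measurable
      finally have A: "?A \<in> sets ?S" .
      have "(\<integral>\<^sup>+ \<zeta>. H r \<zeta> \<partial>?S) = (\<integral>\<^sup>+ \<zeta>. W r * ennreal (1 / r ^ (N + 1)) * indicator ?A \<zeta> \<partial>?S)"
        using True unfolding H_def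
        by (intro nn_integral_cong) (auto simp: indicator_def space_sphere_measure)
      also have "\<dots> = W r * ennreal (1 / r ^ (N + 1)) * emeasure ?S ?A"
        using A by (rule nn_integral_cmult_indicator)
      also have "\<dots> \<le> W r * ennreal (1 / r ^ (N + 1)) * ennreal (C * r ^ N)"
      proof (rule mult_left_mono)
        \<comment> \<open>Enlarging the cap from radius \<open>r / 3\<close> to \<open>r\<close>
          only worsens the constant.\<close>
        have "emeasure ?S ?A \<le> emeasure ?S {\<zeta> \<in> sphere 0 1. dist z \<zeta> \<le> r}"
        proof (rule emeasure_mono)
          have "{\<zeta> \<in> sphere 0 1. dist z \<zeta> \<le> r} = {\<zeta> \<in> space ?S. dist z \<zeta> \<le> r}"
            by (simp add: space_sphere_measure)
          also have "\<dots> \<in> sets ?S" by measurable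
          finally show "{\<zeta> \<in> sphere 0 1. dist z \<zeta> \<le> r} \<in> sets ?S" .
        qed (use True in auto)
        also have "\<dots> \<le> ennreal (C * r ^ N)"
          using True by (intro cap) auto
        finally show "emeasure ?S ?A \<le> ennreal (C * r ^ N)" .
      qed simp
      \<comment> \<open>The powers of \<open>r\<close> cancel down to \<open>1 / r\<close>, which
        leaves the Dini integrand.\<close>
      also have "\<dots> = ennreal C * (W r / ennreal r)"
      proof -
        have "ennreal (1 / r ^ (N + 1)) * ennreal (C * r ^ N) = ennreal (C * (1 / r))"
          using True by (subst ennreal_mult'[symmetric]) auto
        also have "\<dots> = ennreal C * inverse (ennreal r)"
          using True by (simp add: ennreal_mult'' inverse_ennreal divide_inverse)
        finally show ?thesis
          by (simp add: divide_ennreal_def mult_ac)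
      qed
      finally show ?thesis using True by simp
    next
      case False
      then have "H r \<zeta> = 0" for \<zeta> by (auto simp: H_def)
      then show ?thesis by simp
    qed
  qed
  also have "\<dots> = ennreal C * (\<integral>\<^sup>+ r\<in>{0<..<6 * \<delta>}. W r / ennreal r \<partial>lborel)"
    by (intro nn_integral_cmult) measurable
  finally show ?thesis
    by (simp add: mult_left_mono ennreal_mult' mult.assoc)
qed

section \<open>Moduli of continuity and the Dini conditions\<close>

lemma mono_modulus_at: "mono (modulus_at u z)"
  unfolding modulus_at_def by (intro monoI SUP_subset_mono) auto

lemma mono_modulus: "mono (modulus u)"
  unfolding modulus_def by (intro monoI SUP_mono') (rule monoD[OF mono_modulus_at])

lemma abs_diff_le_modulus_at:
  assumes "z \<in> sphere 0 1" "\<zeta> \<in> sphere 0 1"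
  shows "ennreal \<bar>u z - u \<zeta>\<bar> \<le> modulus_at u z (3 * dist z \<zeta>)"
  unfolding modulus_at_def using assms geodesic_dist_le[OF assms] by (intro SUP_upper) auto

lemma modulus_at_le_modulus: "z \<in> sphere 0 1 \<Longrightarrow> modulus_at u z r \<le> modulus u r"
  unfolding modulus_def by (rule SUP_upper)

text \<open>Every fixed \<open>r > 0\<close> eventually leaves the shrinking interval, and
  \<open>g\<close> on \<open>(0, 1)\<close> is an integrable majorant.\<close>

lemma nn_integral_near_0_tendsto:
  fixes g :: "real \<Rightarrow> ennreal"
  assumes [measurable]: "g \<in> borel_measurable borel"
    and fin: "(\<integral>\<^sup>+ r\<in>{0<..<1}. g r \<partial>lborel) < \<infinity>"
  shows "(\<lambda>n. \<integral>\<^sup>+ r\<in>{0<..<1 / Suc n}. g r \<partial>lborel) \<longlonglongrightarrow> 0"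
proof -
  have "(\<lambda>n. \<integral>\<^sup>+ r\<in>{0<..<1 / Suc n}. g r \<partial>lborel) \<longlonglongrightarrow> (\<integral>\<^sup>+ r. 0 \<partial>(lborel::real measure))"
  proof (rule nn_integral_dominated_convergence[where w = "\<lambda>r. g r * indicator {0<..<1} r"])
    show "AE r in lborel. g r * indicator {0<..<1 / Suc n} r \<le> g r * indicator {0<..<1} r" for n
    proof (intro AE_I2 mult_left_mono)
      have le: "1 / real (Suc n) \<le> 1" by (simp add: divide_simps)
      show "indicator {0<..<1 / Suc n} r \<le> (indicator {0<..<1} r :: ennreal)" for r
        by (auto simp del: of_nat_Suc intro: less_le_trans[OF _ le] split: split_indicator)
    qed simp
    show "AE r in lborel. (\<lambda>n. g r * indicator {0<..<1 / real (Suc n)} r) \<longlonglongrightarrow> 0"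
    proof (rule AE_I2)
      fix r :: real
      have "\<forall>\<^sub>F n in sequentially. g r * indicator {0<..<1 / real (Suc n)} r = 0"
      proof (cases "r > 0")
        case True
        then have "\<forall>\<^sub>F n in sequentially. 1 / real (Suc n) < r"
          using LIMSEQ_inverse_real_of_nat by (simp add: order_tendstoD inverse_eq_divide)
        then show ?thesis by eventually_elim auto
      qed simp
      then show "(\<lambda>n. g r * indicator {0<..<1 / real (Suc n)} r) \<longlonglongrightarrow> 0"
        by (rule tendsto_eventually)
    qed
  qed (use fin in \<open>auto\<close>)
  then show ?thesis by simp
qed

text \<open>The case \<open>N = 0\<close> of \<open>mono_le_nn_integral_scale\<close> bounds
  \<open>modulus u s\<close> by twice a tail of the Dini integral, which is small near 0. Continuity
  of \<open>u\<close> is needed for the zeroth-order term of the operator and for the factor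
  \<open>u z\<close> in the truncated integrals.\<close>

lemma uniformly_Dini_continuous_imp_continuous_on:
  assumes "uniformly_Dini_continuous u"
  shows "continuous_on (sphere 0 1) u"
proof (clarsimp simp only: continuous_on_iff)
  fix z :: 'a and e :: real
  assume z: "z \<in> sphere 0 1" and e: "0 < e"
  let ?W = "modulus u"
  have [measurable]: "?W \<in> borel_measurable borel"
    by (rule borel_measurable_ennreal_mono[OF mono_modulus])
  have "(\<lambda>n. ennreal 2 * (\<integral>\<^sup>+ r\<in>{0<..<1 / Suc n}. ?W r / ennreal r \<partial>lborel)) \<longlonglongrightarrow> ennreal 2 * 0"
    using assms unfolding uniformly_Dini_continuous_def
    by (intro ennreal_tendsto_cmult nn_integral_near_0_tendsto) auto
  then have "\<forall>\<^sub>F n in sequentially.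
      ennreal 2 * (\<integral>\<^sup>+ r\<in>{0<..<1 / Suc n}. ?W r / ennreal r \<partial>lborel) < ennreal e"
    by (rule order_tendstoD) (use e in auto)
  then obtain n where n: "ennreal 2 * (\<integral>\<^sup>+ r\<in>{0<..<1 / Suc n}. ?W r / ennreal r \<partial>lborel) < ennreal e"
    by (meson eventually_sequentially order_refl)
  \<comment> \<open>With \<open>?s = 3 * dist z \<zeta>\<close>, the 6 puts the averaging interval
    up to \<open>2 * ?s\<close> inside \<open>(0, 1 / Suc n)\<close>.\<close>
  define \<delta> where "\<delta> = 1 / (6 * real (Suc n))"
  have "\<delta> > 0" by (simp add: \<delta>_def)
  moreover have "dist (u \<zeta>) (u z) < e" if \<zeta>: "\<zeta> \<in> sphere 0 1" "dist \<zeta> z < \<delta>" for \<zeta>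
  proof (cases "\<zeta> = z")
    case False
    let ?s = "3 * dist z \<zeta>"
    have s: "0 < ?s" "2 * ?s \<le> 1 / Suc n"
      using False \<zeta>(2) by (auto simp: \<delta>_def dist_commute field_simps)
    have "ennreal \<bar>u z - u \<zeta>\<bar> \<le> ?W ?s"
      using abs_diff_le_modulus_at[OF z \<zeta>(1)] modulus_at_le_modulus[OF z] order_trans by blast
    also have "\<dots> \<le> ennreal 2 * (\<integral>\<^sup>+ r\<in>{?s..<2 * ?s}. ?W r * ennreal (1 / r) \<partial>lborel)"
      using mono_le_nn_integral_scale[OF mono_modulus s(1), of u 0] by simp
    also have "\<dots> \<le> ennreal 2 * (\<integral>\<^sup>+ r\<in>{0<..<1 / Suc n}. ?W r / ennreal r \<partial>lborel)"
      using s by (intro mult_left_mono nn_integral_mono)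
        (auto simp: indicator_def divide_ennreal_def inverse_ennreal inverse_eq_divide)
    also note n
    finally show ?thesis
      by (simp add: dist_real_def abs_minus_commute ennreal_less_iff)
  qed (use e in simp)
  ultimately show "\<exists>\<delta>>0. \<forall>\<zeta>\<in>sphere 0 1. dist \<zeta> z < \<delta> \<longrightarrow> dist (u \<zeta>) (u z) < e"
    by blast
qed

section \<open>Truncated kernels\<close>

lemma integrable_truncated_kernel:
  fixes f :: "'a::euclidean_space \<Rightarrow> real"
  assumes f: "integrable sphere_measure f" and \<delta>: "0 < \<delta>"
  shows "integrable sphere_measure (\<lambda>\<zeta>. f \<zeta> / max (dist z \<zeta>) \<delta> ^ N)"
proof (rule Bochner_Integration.integrable_bound)
  show "integrable sphere_measure (\<lambda>\<zeta>. f \<zeta> / \<delta> ^ N)"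
    using f by simp
  have [measurable]: "f \<in> borel_measurable sphere_measure"
    using f by (rule borel_measurable_integrable)
  have [measurable]: "(\<lambda>\<zeta>. dist z \<zeta>) \<in> borel_measurable sphere_measure"
    by (rule borel_measurable_sphere_measure) measurable
  show "(\<lambda>\<zeta>. f \<zeta> / max (dist z \<zeta>) \<delta> ^ N) \<in> borel_measurable sphere_measure"
    by measurable
  show "AE \<zeta> in sphere_measure. norm (f \<zeta> / max (dist z \<zeta>) \<delta> ^ N) \<le> norm (f \<zeta> / \<delta> ^ N)"
    using \<delta> by (intro AE_I2) (auto simp: norm_divide norm_power intro!: divide_left_mono power_mono mult_pos_pos)
qed

text \<open>The majorant \<open>\<bar>f \<zeta>\<bar> / \<delta> ^ N\<close> is independent of
  \<open>z\<close>. The density \<open>f\<close> is general because both \<open>f = u\<close> and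
  the constant 1 occur later.\<close>

lemma continuous_on_truncated_potential:
  fixes f :: "'a::euclidean_space \<Rightarrow> real"
  assumes f: "integrable sphere_measure f" and \<delta>: "0 < \<delta>"
  shows "continuous_on A (\<lambda>z. \<integral>\<zeta>. f \<zeta> / max (dist z \<zeta>) \<delta> ^ N \<partial>sphere_measure)"
proof (unfold continuous_on_sequentially, intro allI ballI impI)
  fix x :: "nat \<Rightarrow> 'a" and z
  assume "z \<in> A" and x: "(\<forall>n. x n \<in> A) \<and> x \<longlonglongrightarrow> z"
  have "(\<lambda>n. \<integral>\<zeta>. f \<zeta> / max (dist (x n) \<zeta>) \<delta> ^ N \<partial>sphere_measure) \<longlonglongrightarrow>
      (\<integral>\<zeta>. f \<zeta> / max (dist z \<zeta>) \<delta> ^ N \<partial>sphere_measure)"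
  proof (rule integral_dominated_convergence[where w = "\<lambda>\<zeta>. norm (f \<zeta> / \<delta> ^ N)"])
    show "integrable sphere_measure (\<lambda>\<zeta>. norm (f \<zeta> / \<delta> ^ N))"
      using f by simp
    show "AE \<zeta> in sphere_measure. (\<lambda>n. f \<zeta> / max (dist (x n) \<zeta>) \<delta> ^ N)
        \<longlonglongrightarrow> f \<zeta> / max (dist z \<zeta>) \<delta> ^ N"
      using x \<delta> by (intro AE_I2 tendsto_intros) auto
    show "AE \<zeta> in sphere_measure. norm (f \<zeta> / max (dist (x n) \<zeta>) \<delta> ^ N) \<le> norm (f \<zeta> / \<delta> ^ N)" for n
      using \<delta> by (intro AE_I2) (auto simp: norm_divide norm_power intro!: divide_left_mono power_mono mult_pos_pos)
  qed (intro borel_measurable_integrable integrable_truncated_kernel f \<delta>)+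
  then show "((\<lambda>z. \<integral>\<zeta>. f \<zeta> / max (dist z \<zeta>) \<delta> ^ N \<partial>sphere_measure) \<circ> x) \<longlonglongrightarrow>
      (\<integral>\<zeta>. f \<zeta> / max (dist z \<zeta>) \<delta> ^ N \<partial>sphere_measure)"
    by (simp add: o_def)
qed

section \<open>Error of truncation near the singularity\<close>

text \<open>\<open>W\<close> is left abstract to serve twice: as \<open>modulus_at u z\<close> for
  convergence at one point, and as \<open>modulus u\<close> for a bound independent of
  \<open>z\<close>.\<close>

lemma nn_integral_log_kernel_near_le:
  fixes W :: "real \<Rightarrow> ennreal" and z :: "'a::euclidean_space"
  assumes W: "mono W"
    and cap: "\<And>r. 0 < r \<Longrightarrow>
      emeasure sphere_measure {\<zeta> \<in> sphere 0 1. dist z \<zeta> \<le> r} \<le> ennreal (C * r ^ N)"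
    and u: "\<And>\<zeta>. \<zeta> \<in> sphere 0 1 \<Longrightarrow> ennreal \<bar>u z - u \<zeta>\<bar> \<le> W (3 * dist z \<zeta>)"
  shows "(\<integral>\<^sup>+ \<zeta>\<in>{\<zeta>. dist z \<zeta> < \<delta>}. ennreal \<bar>log_kernel_integrand N u z \<zeta>\<bar> \<partial>sphere_measure)
    \<le> ennreal (3 ^ N * 2 ^ (N + 1) * C) * (\<integral>\<^sup>+ r\<in>{0<..<6 * \<delta>}. W r / ennreal r \<partial>lborel)"
proof (rule order_trans[OF nn_integral_mono nn_integral_singular_kernel_le[OF W cap]])
  fix \<zeta>
  assume "\<zeta> \<in> space (sphere_measure :: 'a measure)"
  then have \<zeta>: "\<zeta> \<in> sphere 0 1" by (simp add: space_sphere_measure)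
  show "ennreal \<bar>log_kernel_integrand N u z \<zeta>\<bar> * indicator {\<zeta>. dist z \<zeta> < \<delta>} \<zeta>
      \<le> W (3 * dist z \<zeta>) * ennreal (1 / dist z \<zeta> ^ N) *
        indicator {\<zeta>. 0 < dist z \<zeta> \<and> dist z \<zeta> < \<delta>} \<zeta>"
  \<comment> \<open>At \<open>\<zeta> = z\<close> the numerator \<open>u z - u \<zeta>\<close>
    vanishes, so the indicator on the right may exclude that point.\<close>
  proof (cases "0 < dist z \<zeta>")
    case True
    have "\<bar>log_kernel_integrand N u z \<zeta>\<bar> = \<bar>u z - u \<zeta>\<bar> * (1 / dist z \<zeta> ^ N)"
      by (simp add: log_kernel_integrand_def dist_norm abs_divide)
    then have "ennreal \<bar>log_kernel_integrand N u z \<zeta>\<bar> = ennreal \<bar>u z - u \<zeta>\<bar> * ennreal (1 / dist z \<zeta> ^ N)"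
      by (simp only: ennreal_mult'' zero_le_divide_1_iff zero_le_power zero_le_dist)
    also have "\<dots> \<le> W (3 * dist z \<zeta>) * ennreal (1 / dist z \<zeta> ^ N)"
      by (intro mult_right_mono u \<zeta>) simp
    finally show ?thesis
      using True by (simp add: indicator_def)
  qed (simp add: log_kernel_integrand_def)
qed auto

text \<open>The kernels agree at distance at least \<open>\<delta>\<close>. Closer in, truncation
  only decreases the kernel and keeps it nonnegative, so the difference is at most the
  original.\<close>

lemma abs_log_kernel_diff_truncated_le:
  assumes "0 < \<delta>"
  shows "\<bar>log_kernel_integrand N u z \<zeta> - (u z - u \<zeta>) / max (dist z \<zeta>) \<delta> ^ N\<bar>
    \<le> \<bar>log_kernel_integrand N u z \<zeta>\<bar> * indicator {\<zeta>. dist z \<zeta> < \<delta>} \<zeta>"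
proof (cases "0 < dist z \<zeta> \<and> dist z \<zeta> < \<delta>")
  case True
  define a b where "a = 1 / dist z \<zeta> ^ N" and "b = 1 / \<delta> ^ N"
  have ab: "0 \<le> b" "b \<le> a"
    using True assms unfolding a_def b_def
    by (auto intro!: divide_left_mono power_mono mult_pos_pos)
  have "log_kernel_integrand N u z \<zeta> = (u z - u \<zeta>) * a"
    by (simp add: log_kernel_integrand_def dist_norm a_def)
  moreover have "(u z - u \<zeta>) / max (dist z \<zeta>) \<delta> ^ N = (u z - u \<zeta>) * b"
    using True by (simp add: b_def max_def)
  moreover have "\<bar>u z - u \<zeta>\<bar> * \<bar>a - b\<bar> \<le> \<bar>u z - u \<zeta>\<bar> * \<bar>a\<bar>"
    using ab by (intro mult_left_mono) auto
  ultimately show ?thesis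
    using True by (simp add: abs_mult flip: right_diff_distrib)
qed (use assms in \<open>auto simp: log_kernel_integrand_def dist_norm max_def\<close>)

section \<open>Convergence and continuity of the singular integral\<close>

lemma integrable_log_kernel:
  fixes u :: "'a::euclidean_space \<Rightarrow> real"
  assumes d: "DIM('a) = N + 1" and u: "integrable sphere_measure u"
    and z: "z \<in> sphere 0 1" and dini: "Dini_continuous_at u z"
  shows "integrable sphere_measure (log_kernel_integrand N u z)"
proof (rule integrableI_bounded)
  interpret finite_measure "sphere_measure :: 'a measure"
    by (rule finite_measure_sphere_measure)
  have [measurable]: "u \<in> borel_measurable sphere_measure"
    using u by (rule borel_measurable_integrable)
  have [measurable]: "(\<lambda>\<zeta>. norm (z - \<zeta>)) \<in> borel_measurable sphere_measure"
    "(\<lambda>\<zeta>. dist z \<zeta>) \<in> borel_measurable sphere_measure"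
    by (rule borel_measurable_sphere_measure, measurable)+
  show K[measurable]: "log_kernel_integrand N u z \<in> borel_measurable sphere_measure"
    unfolding log_kernel_integrand_def by measurable
  \<comment> \<open>The cutoff \<open>1 / 6\<close> turns the range \<open>6 * \<delta>\<close> of
    the near estimate into 1, the range of the Dini integral. \<open>?T\<close> is integrable since
    \<open>u\<close> is and the measure is finite, which handles the constant
    \<open>u z\<close>.\<close>
  let ?T = "\<lambda>\<zeta>. (u z - u \<zeta>) / max (dist z \<zeta>) (1 / 6) ^ N"
  have T: "integrable sphere_measure ?T"
    using u by (intro integrable_truncated_kernel) auto
  obtain C where C: "\<And>z r. z \<in> sphere (0::'a) 1 \<Longrightarrow> 0 < r \<Longrightarrow>
      emeasure sphere_measure {\<zeta> \<in> sphere 0 1. dist z \<zeta> \<le> r} \<le> ennreal (C * r ^ N)"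
    using emeasure_spherical_cap_le[OF d] by blast
  have near: "(\<integral>\<^sup>+ \<zeta>\<in>{\<zeta>. dist z \<zeta> < 1 / 6}. ennreal \<bar>log_kernel_integrand N u z \<zeta>\<bar> \<partial>sphere_measure) < \<infinity>"
    using nn_integral_log_kernel_near_le[OF mono_modulus_at C[OF z] abs_diff_le_modulus_at[OF z], of u "1 / 6"]
      dini unfolding Dini_continuous_at_def
    by (auto simp: ennreal_mult_less_top elim!: le_less_trans)
  have "(\<integral>\<^sup>+ \<zeta>. ennreal (norm (log_kernel_integrand N u z \<zeta>)) \<partial>sphere_measure)
      \<le> (\<integral>\<^sup>+ \<zeta>. ennreal (norm (?T \<zeta>)) +
          ennreal \<bar>log_kernel_integrand N u z \<zeta>\<bar> * indicator {\<zeta>. dist z \<zeta> < 1 / 6} \<zeta> \<partial>sphere_measure)"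
  proof (rule nn_integral_mono)
    fix \<zeta>
    have "\<bar>log_kernel_integrand N u z \<zeta>\<bar> \<le>
        \<bar>?T \<zeta>\<bar> + \<bar>log_kernel_integrand N u z \<zeta>\<bar> * indicator {\<zeta>. dist z \<zeta> < 1 / 6} \<zeta>"
      using abs_log_kernel_diff_truncated_le[of "1 / 6" N u z \<zeta>] by linarith
    then show "ennreal (norm (log_kernel_integrand N u z \<zeta>)) \<le> ennreal (norm (?T \<zeta>)) +
          ennreal \<bar>log_kernel_integrand N u z \<zeta>\<bar> * indicator {\<zeta>. dist z \<zeta> < 1 / 6} \<zeta>"
      by (auto simp: indicator_def simp flip: ennreal_plus intro!: ennreal_leI split: if_splits)
  qed
  also have "\<dots> = (\<integral>\<^sup>+ \<zeta>. ennreal (norm (?T \<zeta>)) \<partial>sphere_measure) +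
      (\<integral>\<^sup>+ \<zeta>\<in>{\<zeta>. dist z \<zeta> < 1 / 6}. ennreal \<bar>log_kernel_integrand N u z \<zeta>\<bar> \<partial>sphere_measure)"
    by (rule nn_integral_add) measurable
  also have "\<dots> < \<infinity>"
    using near T by (simp add: integrable_iff_bounded)
  finally show "(\<integral>\<^sup>+ \<zeta>. ennreal (norm (log_kernel_integrand N u z \<zeta>)) \<partial>sphere_measure) < \<infinity>" .
qed

lemma continuous_on_integral_log_kernel:
  fixes u :: "'a::euclidean_space \<Rightarrow> real"
  assumes d: "DIM('a) = N + 1" and u: "integrable sphere_measure u"
    and dini: "uniformly_Dini_continuous u"
  shows "continuous_on (sphere 0 1) (\<lambda>z. \<integral>\<zeta>. log_kernel_integrand N u z \<zeta> \<partial>sphere_measure)"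
proof (rule uniform_limit_theorem)
  interpret finite_measure "sphere_measure :: 'a measure"
    by (rule finite_measure_sphere_measure)
  \<comment> \<open>Chosen so that \<open>6 * \<delta> n = 1 / Suc n\<close>, the range in
    \<open>nn_integral_near_0_tendsto\<close>.\<close>
  define \<delta> where "\<delta> n = 1 / (6 * real (Suc n))" for n
  have \<delta>: "\<delta> n > 0" for n by (simp add: \<delta>_def)
  let ?T = "\<lambda>n z \<zeta>. (u z - u \<zeta>) / max (dist z \<zeta>) (\<delta> n) ^ N"
  let ?tail = "\<lambda>n. \<integral>\<^sup>+ r\<in>{0<..<1 / Suc n}. modulus u r / ennreal r \<partial>lborel"
  have [measurable]: "modulus u \<in> borel_measurable borel"
    by (rule borel_measurable_ennreal_mono[OF mono_modulus])
  have int_T: "integrable sphere_measure (?T n z)" for n z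
    using u by (intro integrable_truncated_kernel \<delta>) auto
  show "\<forall>\<^sub>F n in sequentially. continuous_on (sphere 0 1) (\<lambda>z. \<integral>\<zeta>. ?T n z \<zeta> \<partial>sphere_measure)"
  proof (rule always_eventually, rule allI)
    fix n
    \<comment> \<open>The numerator also depends on \<open>z\<close>. Splitting it leaves two
      potentials with fixed densities and the continuous factor \<open>u z\<close>.\<close>
    have "(\<integral>\<zeta>. ?T n z \<zeta> \<partial>sphere_measure) =
        u z * (\<integral>\<zeta>. 1 / max (dist z \<zeta>) (\<delta> n) ^ N \<partial>sphere_measure) -
        (\<integral>\<zeta>. u \<zeta> / max (dist z \<zeta>) (\<delta> n) ^ N \<partial>sphere_measure)" for z
    proof -
      have "(\<integral>\<zeta>. ?T n z \<zeta> \<partial>sphere_measure) =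
          (\<integral>\<zeta>. u z * (1 / max (dist z \<zeta>) (\<delta> n) ^ N) - u \<zeta> / max (dist z \<zeta>) (\<delta> n) ^ N \<partial>sphere_measure)"
        by (simp add: diff_divide_distrib)
      also have "\<dots> = (\<integral>\<zeta>. u z * (1 / max (dist z \<zeta>) (\<delta> n) ^ N) \<partial>sphere_measure) -
        (\<integral>\<zeta>. u \<zeta> / max (dist z \<zeta>) (\<delta> n) ^ N \<partial>sphere_measure)"
        by (intro Bochner_Integration.integral_diff integrable_mult_right integrable_truncated_kernel u \<delta>) simp
      finally show ?thesis
        by (simp only: integral_mult_right_zero)
    qed
    then show "continuous_on (sphere 0 1) (\<lambda>z. \<integral>\<zeta>. ?T n z \<zeta> \<partial>sphere_measure)"
      by (simp only:) (intro continuous_intros continuous_on_truncated_potential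
          uniformly_Dini_continuous_imp_continuous_on dini u \<delta>; simp)
  qed
  obtain C where C: "\<And>z r. z \<in> sphere (0::'a) 1 \<Longrightarrow> 0 < r \<Longrightarrow>
      emeasure sphere_measure {\<zeta> \<in> sphere 0 1. dist z \<zeta> \<le> r} \<le> ennreal (C * r ^ N)"
    using emeasure_spherical_cap_le[OF d] by blast
  define D where "D = 3 ^ N * 2 ^ (N + 1) * C"
  have lim: "(\<lambda>n. ennreal D * ?tail n) \<longlonglongrightarrow> ennreal D * 0"
    using dini unfolding uniformly_Dini_continuous_def
    by (intro ennreal_tendsto_cmult nn_integral_near_0_tendsto) auto
  \<comment> \<open>The right-hand side does not involve \<open>z\<close>, so the convergence is
    uniform on the sphere.\<close>
  have close: "ennreal (norm ((\<integral>\<zeta>. ?T n z \<zeta> \<partial>sphere_measure) -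
      (\<integral>\<zeta>. log_kernel_integrand N u z \<zeta> \<partial>sphere_measure))) \<le> ennreal D * ?tail n"
    if z: "z \<in> sphere 0 1" for n z
  proof -
    have W: "ennreal \<bar>u z - u \<zeta>\<bar> \<le> modulus u (3 * dist z \<zeta>)" if "\<zeta> \<in> sphere 0 1" for \<zeta>
      using abs_diff_le_modulus_at[OF z that] modulus_at_le_modulus[OF z] order_trans by blast
    \<comment> \<open>Uniform Dini continuity gives Dini continuity at \<open>z\<close>, hence
      integrability of the kernel integrand. Without it the difference of the two integrals could
      not be written as the integral of the difference.\<close>
    have "(\<integral>\<^sup>+ r\<in>{0<..<1}. modulus_at u z r / ennreal r \<partial>lborel)
        \<le> (\<integral>\<^sup>+ r\<in>{0<..<1}. modulus u r / ennreal r \<partial>lborel)"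
      by (intro nn_integral_mono mult_right_mono divide_right_mono_ennreal modulus_at_le_modulus z) simp
    then have "Dini_continuous_at u z"
      using dini unfolding uniformly_Dini_continuous_def Dini_continuous_at_def by (rule le_less_trans)
    then have int_K: "integrable sphere_measure (log_kernel_integrand N u z)"
      by (rule integrable_log_kernel[OF d u z])
    have "ennreal (norm ((\<integral>\<zeta>. ?T n z \<zeta> \<partial>sphere_measure) -
        (\<integral>\<zeta>. log_kernel_integrand N u z \<zeta> \<partial>sphere_measure))) =
        ennreal (norm (\<integral>\<zeta>. ?T n z \<zeta> - log_kernel_integrand N u z \<zeta> \<partial>sphere_measure))"
      by (simp add: Bochner_Integration.integral_diff[OF int_T int_K])
    also have "\<dots> \<le> (\<integral>\<^sup>+ \<zeta>. norm (?T n z \<zeta> - log_kernel_integrand N u z \<zeta>) \<partial>sphere_measure)"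
      by (intro integral_norm_bound_ennreal Bochner_Integration.integrable_diff int_T int_K)
    also have "\<dots> \<le> (\<integral>\<^sup>+ \<zeta>\<in>{\<zeta>. dist z \<zeta> < \<delta> n}. ennreal \<bar>log_kernel_integrand N u z \<zeta>\<bar> \<partial>sphere_measure)"
    proof (rule nn_integral_mono)
      fix \<zeta>
      show "ennreal (norm (?T n z \<zeta> - log_kernel_integrand N u z \<zeta>))
          \<le> ennreal \<bar>log_kernel_integrand N u z \<zeta>\<bar> * indicator {\<zeta>. dist z \<zeta> < \<delta> n} \<zeta>"
        using abs_log_kernel_diff_truncated_le[OF \<delta>[of n], of N u z \<zeta>]
        by (auto simp: indicator_def abs_minus_commute intro!: ennreal_leI split: if_splits)
    qed
    also have "\<dots> \<le> ennreal D * (\<integral>\<^sup>+ r\<in>{0<..<6 * \<delta> n}. modulus u r / ennreal r \<partial>lborel)"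
      unfolding D_def by (rule nn_integral_log_kernel_near_le[OF mono_modulus C[OF z] W])
    also have "6 * \<delta> n = 1 / Suc n"
      by (simp add: \<delta>_def del: of_nat_Suc)
    finally show ?thesis .
  qed
  show "uniform_limit (sphere 0 1) (\<lambda>n z. \<integral>\<zeta>. ?T n z \<zeta> \<partial>sphere_measure)
      (\<lambda>z. \<integral>\<zeta>. log_kernel_integrand N u z \<zeta> \<partial>sphere_measure) sequentially"
  proof (rule uniform_limitI)
    fix e :: real
    assume e: "0 < e"
    have "\<forall>\<^sub>F n in sequentially. ennreal D * ?tail n < ennreal e"
      using lim by (rule order_tendstoD) (use e in auto)
    then show "\<forall>\<^sub>F n in sequentially. \<forall>z\<in>sphere 0 1.
        dist (\<integral>\<zeta>. ?T n z \<zeta> \<partial>sphere_measure) (\<integral>\<zeta>. log_kernel_integrand N u z \<zeta> \<partial>sphere_measure) < e"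
    proof eventually_elim
      case (elim n)
      show ?case
      proof
        fix z :: 'a
        assume "z \<in> sphere 0 1"
        from le_less_trans[OF close[OF this] elim]
        show "dist (\<integral>\<zeta>. ?T n z \<zeta> \<partial>sphere_measure)
            (\<integral>\<zeta>. log_kernel_integrand N u z \<zeta> \<partial>sphere_measure) < e"
          by (simp add: dist_norm ennreal_less_iff)
      qed
    qed
  qed
qed simp

theorem proposition1p2:
  fixes N :: nat and u :: "'a::euclidean_space \<Rightarrow> real"
  assumes "N \<ge> 1" and "DIM('a) = N + 1"
    and "integrable sphere_measure u"
  shows "(\<forall>z \<in> sphere 0 1. Dini_continuous_at u z \<longrightarrow>
             integrable sphere_measure (log_kernel_integrand N u z)) \<and>
         (uniformly_Dini_continuous u \<longrightarrow>
             continuous_on (sphere 0 1) (conf_log_laplacian N u))"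
proof (intro conjI ballI impI)
  show "integrable sphere_measure (log_kernel_integrand N u z)"
    if "z \<in> sphere 0 1" "Dini_continuous_at u z" for z
    using assms that by (intro integrable_log_kernel)
  \<comment> \<open>The integral term and the term with \<open>A_const N\<close> are treated
    separately; the latter needs the continuity of \<open>u\<close> itself.\<close>
  show "continuous_on (sphere 0 1) (conf_log_laplacian N u)" if "uniformly_Dini_continuous u"
    unfolding conf_log_laplacian_def
    using assms that by (intro continuous_intros continuous_on_integral_log_kernel
        uniformly_Dini_continuous_imp_continuous_on)
qed

end
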